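(* Let $w[i+1\dots i+n]$ be a $g$-word embedded in a palindromic periodicity $w$. Then: (a) the $g$-word $w[i+1\dots i+n]$ is a power of a palindrome of length $g$; and (b) this periodicity extends to the whole of the embedding palindromic periodicity, i.e. $w$ has period $g$.
   Context: Words are finite sequences of letters $w=w[1]w[2]\cdots$, $|w|$ is the length, and $w[a\dots b]$ denotes the factor occupying positions $a$ to $b$. A word is a palindrome if it equals its reverse; the empty word is a palindrome. If $w[a\dots b]$ is a palindrome, its centre is $(a+b)/2$. A word $w$ has period $q$ if $w[j]=w[j+q]$ whenever both positions are in $w$. For a nonempty word $x$, $x^\omega=xxx\cdots$. A power of a word $x$ is a word $x^k=xx\cdots x$ ($k\ge 1$ copies). A palindromic periodicity is a factor, of length at least $|ps|\ge 1$, of an infinite word $(ps)^\omega$ where $p$ and $s$ are palindromes (either may be empty). Every palindromic periodicity is a prefix of such an infinite word; if $w$ is a prefix of $(ps)^\omega$ with $p,s$ palindromes and $|w|\ge |ps|$, then its half-period is $h=|ps|/2$, its offset is the position $r=(|p|+1)/2$ of the centre of the initial $p$, and its essential (palindromic) centres are the positions $r, r+h, r+2h,\dots$ (the centres of the successive occurrences of $p$ and $s$). Here $2r$ and $2h$ are integers. A $g$-word is a non-empty palindrome $w[i+1\dots i+n]$ with centre $c=i+(n+1)/2$ which is embedded in (i.e. is a factor occurrence of) a palindromic periodicity $w$ with half-period $h$ and offset $r$, and whose length is $n=2h-g$, where $$g=\gcd(2|c-r|,\,2h).$$ (Non-emptiness means that $g\ne 2h$.) *)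

theory Defs
  imports Complex_Main "HOL-Library.Omega_Words_Fun"
begin

definition palindrome :: "'a list \<Rightarrow> bool"
  where "palindrome w \<longleftrightarrow> rev w = w"

text \<open>Positions are numbered from 1, so that the letter at position \<open>k\<close> is \<open>w ! (k - 1)\<close>; only used
  for \<open>1 \<le> a\<close> and \<open>b \<le> length w\<close>.\<close>

definition factor :: "'a list \<Rightarrow> nat \<Rightarrow> nat \<Rightarrow> 'a list"
  where "factor w a b = take (b + 1 - a) (drop (a - 1) w)"

definition centre :: "nat \<Rightarrow> nat \<Rightarrow> real"
  where "centre a b = (real a + real b) / 2"

definition has_period :: "'a list \<Rightarrow> nat \<Rightarrow> bool"
  where "has_period w q \<longleftrightarrow> (\<forall>j. j + q < length w \<longrightarrow> w ! j = w ! (j + q))"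

definition palindromic_periodicity :: "'a list \<Rightarrow> bool"
  where "palindromic_periodicity w \<longleftrightarrow>
    (\<exists>p s j. palindrome p \<and> palindrome s \<and> 1 \<le> length (p @ s) \<and> length (p @ s) \<le> length w \<and>
       w = subsequence ((p @ s)\<^sup>\<omega>) j (j + length w))"

text \<open>A palindromic periodicity may be a prefix of \<open>(p @ s)\<^sup>\<omega>\<close> for several pairs \<open>(p, s)\<close>. The half-period
  and offset are therefore attached to a choice of such a pair: the following relation says that
  some choice gives half-period \<open>h\<close> and offset \<open>r\<close>.\<close>

definition half_period_offset :: "'a list \<Rightarrow> real \<Rightarrow> real \<Rightarrow> bool"
  where "half_period_offset w h r \<longleftrightarrow>
    (\<exists>p s. palindrome p \<and> palindrome s \<and> 1 \<le> length (p @ s) \<and> length (p @ s) \<le> length w \<and>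
       w = prefix (length w) ((p @ s)\<^sup>\<omega>) \<and>
       h = real (length (p @ s)) / 2 \<and> r = (real (length p) + 1) / 2)"

text \<open>\<open>g_word g w h r i n\<close>: the factor at positions \<open>i + 1, \<dots>, i + n\<close> of \<open>w\<close> is a \<open>g\<close>-word with
  respect to half-period \<open>h\<close> and offset \<open>r\<close> of \<open>w\<close>. The numbers under the floors are integers
  (see the lemmas below), so the floors only convert types.\<close>

definition g_word :: "nat \<Rightarrow> 'a list \<Rightarrow> real \<Rightarrow> real \<Rightarrow> nat \<Rightarrow> nat \<Rightarrow> bool"
  where "g_word g w h r i n \<longleftrightarrow>
    palindromic_periodicity w \<and> half_period_offset w h r \<and>
    i + n \<le> length w \<and> n \<noteq> 0 \<and> palindrome (factor w (i + 1) (i + n)) \<and>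
    g = gcd (nat \<lfloor>2 * \<bar>centre (i + 1) (i + n) - r\<bar>\<rfloor>) (nat \<lfloor>2 * h\<rfloor>) \<and>
    real n = 2 * h - real g"

lemma half_period_offset_imp_palindromic_periodicity:
  assumes "half_period_offset w h r"
  shows "palindromic_periodicity w"
proof -
  from assms obtain p s where "palindrome p" "palindrome s" "1 \<le> length (p @ s)"
    "length (p @ s) \<le> length w" "w = prefix (length w) ((p @ s)\<^sup>\<omega>)"
    unfolding half_period_offset_def by blast
  then show ?thesis
    unfolding palindromic_periodicity_def
    by (intro exI[of _ p] exI[of _ s] exI[of _ 0]) simp
qed

lemma half_period_floor_exact:
  assumes "half_period_offset w h r"
  shows "real (nat \<lfloor>2 * h\<rfloor>) = 2 * h"
proof -
  from assms obtain p s :: "'a list" where "h = real (length (p @ s)) / 2"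
    unfolding half_period_offset_def by blast
  then have "2 * h = real (length (p @ s))" by simp
  then show ?thesis by (simp only: floor_of_nat nat_int)
qed

lemma centre_distance_floor_exact:
  assumes "half_period_offset w h r"
  shows "real (nat \<lfloor>2 * \<bar>centre a b - r\<bar>\<rfloor>) = 2 * \<bar>centre a b - r\<bar>"
proof -
  from assms obtain p :: "'a list" where r: "r = (real (length p) + 1) / 2"
    unfolding half_period_offset_def by blast
  have "2 * \<bar>centre a b - r\<bar> = \<bar>2 * (centre a b - r)\<bar>" by (simp only: abs_mult abs_numeral)
  also have "2 * (centre a b - r) = real_of_int (int a + int b - int (length p) - 1)"
    unfolding r centre_def by (simp add: field_simps)
  also have "\<bar>\<dots>\<bar> = real (nat \<bar>int a + int b - int (length p) - 1\<bar>)" by simp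
  finally have "2 * \<bar>centre a b - r\<bar> = real (nat \<bar>int a + int b - int (length p) - 1\<bar>)" .
  then show ?thesis by (simp only: floor_of_nat nat_int)
qed

end

theory Submission
  imports Defs
begin

text \<open>
  Number positions from 0 and put \<open>L = 2h = |ps|\<close> and \<open>P = |p|\<close>. Extended to all integers, the
  periodic word \<open>U = \<dots>psps\<dots>\<close> has period \<open>L\<close> and is symmetric under \<open>j \<mapsto> P - 1 - j\<close>, because
  \<open>p\<close> and \<open>s\<close> are palindromes. A \<open>g\<close>-word at positions \<open>i, \<dots>, i + n - 1\<close> gives, inside its own
  range only, the second reflection \<open>j \<mapsto> 2i + n - 1 - j\<close>. Composing the two shows \<open>U j = U (j - D)\<close>
  for \<open>j\<close> in that range, where \<open>D = 2i + n - P = 2(c - r)\<close>, so that \<open>g = gcd D L\<close>.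

  Modulo \<open>L\<close>, the translation by \<open>D\<close> permutes each residue class modulo \<open>g\<close> as a single cycle.
  The range has length \<open>L - g\<close>, so it misses exactly one member of each class modulo \<open>g\<close>: every
  cycle loses one link and becomes a path, which is still connected. Hence \<open>U\<close> is constant on the classes
  modulo \<open>g\<close>, which is the period of \<open>w\<close> (\<open>period_gcd_of_partial_translation\<close>).

  Since \<open>g\<close> divides \<open>L\<close>, it divides \<open>n = L - g\<close>, so the \<open>g\<close>-word is a whole power of its prefix of
  length \<open>g\<close>; reversing the power reverses its base, so the base is a palindrome as well
  (\<open>palindromic_power_base\<close>).
\<close>

lemma eq_of_period_dvd_diff:
  fixes U :: "int \<Rightarrow> 'a"
  assumes per: "\<And>j. U (j + L) = U j" and "L dvd a - b"
  shows "U a = U b"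
proof -
  have nonneg: "U (j + int k * L) = U j" for j k
  proof (induction k)
    case (Suc k)
    have "j + int (Suc k) * L = (j + int k * L) + L" by (simp add: algebra_simps)
    then show ?case using per[of "j + int k * L"] Suc by (simp only:)
  qed simp
  obtain q where q: "a - b = L * q" using assms(2) by (elim dvdE)
  show ?thesis
  proof (cases "q \<ge> 0")
    case True
    have "a = b + int (nat q) * L" using q True by (simp add: algebra_simps)
    then show ?thesis using nonneg by metis
  next
    case False
    have "b = a + int (nat (- q)) * L" using q False by (simp add: algebra_simps)
    then show ?thesis using nonneg by metis
  qed
qed

text \<open>Each class modulo \<open>g\<close> has one representative \<open>e\<close> in the gap \<open>[i + L - g, i + L)\<close>. Walking from
  \<open>e\<close> in steps of \<open>D\<close>, the value of \<open>U\<close> can only change where the walk is in the gap modulo \<open>L\<close>; but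
  there it is back at \<open>e\<close> modulo \<open>L\<close>, and its value is the initial one.\<close>

lemma period_gcd_of_partial_translation:
  fixes U :: "int \<Rightarrow> 'a"
  assumes L: "L > 0" and per: "\<And>j. U (j + L) = U j" and g: "g = gcd D L"
    and shift: "\<And>j. i \<le> j \<Longrightarrow> j < i + L - g \<Longrightarrow> U j = U (j - D)"
  shows "U (j + g) = U j"
proof -
  have cong: "U a = U b" if "L dvd a - b" for a b
    using eq_of_period_dvd_diff[of U L a b] per that by blast
  have gpos: "g > 0" using g L by simp
  have gD: "g dvd D" and gL: "g dvd L" using g by auto
  define e where "e = i + L - g + (j - (i + L - g)) mod g"
  have e_gap: "i + L - g \<le> e" "e < i + L"
    using gpos pos_mod_bound[OF gpos, of "j - (i + L - g)"] by (auto simp: e_def)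
  have e_class: "g dvd j - e"
    unfolding e_def by (metis diff_diff_eq dvd_minus_mod)
  have walk: "U (e + int k * D) = U e" for k
  proof (induction k)
    case (Suc k)
    let ?x = "e + int (Suc k) * D"
    show ?case
    proof (cases "L dvd ?x - e")
      case True
      then show ?thesis using cong by blast
    next
      case False
      define y where "y = i + (?x - i) mod L"
      have y: "i \<le> y" "y < i + L" using L by (auto simp: y_def)
      have xy: "L dvd ?x - y"
        unfolding y_def by (metis diff_diff_eq dvd_minus_mod)
      have "y < i + L - g"
      proof (rule ccontr)
        assume gap: "\<not> y < i + L - g"
        have "g dvd ?x - e" using gD by simp
        moreover have "g dvd ?x - y" using xy gL by (rule dvd_trans[rotated])
        ultimately have "g dvd (?x - e) - (?x - y)" by (rule dvd_diff)
        then have "g dvd y - e" by (simp add: algebra_simps)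
        moreover have "\<bar>y - e\<bar> < g" using gap y e_gap by simp
        ultimately have "y = e" using dvd_imp_le_int[of "y - e" g] gpos by fastforce
        then show False using xy False by simp
      qed
      then have "U y = U (y - D)" using shift y by blast
      moreover have "U ?x = U y" using cong[OF xy] .
      moreover have "U (?x - D) = U (y - D)"
        using cong[of "?x - D" "y - D"] xy by (simp only: diff_diff_eq2 diff_add_cancel)
      moreover have "?x - D = e + int k * D" by (simp add: algebra_simps)
      ultimately show ?thesis using Suc by (simp only:)
    qed
  qed simp
  have const: "U x = U e" if x: "g dvd x - e" for x
  proof -
    obtain q where q: "x - e = g * q" using x by (elim dvdE)
    obtain a b where ab: "a * D + b * L = g" using bezout_int g by metis
    \<comment> \<open>Bezout gives a possibly negative number \<open>q * a\<close> of steps from \<open>e\<close> to \<open>x\<close>; reducing it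
        modulo \<open>L\<close> makes it a length of a forward walk.\<close>
    define k where "k = nat ((q * a) mod L)"
    have "L dvd q * a - int k" unfolding k_def using L by simp
    then obtain c where c: "q * a - int k = L * c" by (elim dvdE)
    have "x - (e + int k * D) = q * (a * D + b * L) - int k * D"
      using q ab by (simp add: algebra_simps)
    also have "\<dots> = (q * a - int k) * D + q * b * L" by (simp add: algebra_simps)
    also have "\<dots> = L * (c * D + q * b)" unfolding c by (simp add: algebra_simps)
    finally have "L dvd x - (e + int k * D)" by simp
    then have "U x = U (e + int k * D)" using cong by blast
    then show ?thesis using walk by simp
  qed
  have "g dvd j + g - e" using dvd_add[OF e_class dvd_refl] by (simp add: algebra_simps)
  then show ?thesis using const e_class by metis
qed

lemma nth_palindrome:
  assumes "palindrome v" "j < length v"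
  shows "v ! j = v ! (length v - 1 - j)"
  using assms rev_nth[of j v] by (simp add: palindrome_def)

text \<open>The reflection maps the block \<open>p\<close> to itself, and the block \<open>s\<close> to the \<open>s\<close> of the preceding
  period.\<close>

lemma palindrome_pair_reflection:
  fixes p s :: "'a list"
  defines "L \<equiv> int (length (p @ s))"
  assumes p: "palindrome p" and s: "palindrome s" and ne: "p @ s \<noteq> []"
  shows "(p @ s) ! nat ((int (length p) - 1 - j) mod L) = (p @ s) ! nat (j mod L)"
proof -
  define m where "m = nat (j mod L)"
  define P where "P = length p"
  have L: "L > 0" using ne by (simp only: L_def of_nat_0_less_iff length_greater_0_conv not_False_eq_True)
  have m: "int m = j mod L" using L by (simp add: m_def)
  have mL: "m < length p + length s" using pos_mod_bound[OF L, of j] m by (simp add: L_def)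
  have refl: "(int P - 1 - j) mod L = (int P - 1 - int m) mod L"
    unfolding m by (simp add: mod_diff_right_eq)
  show ?thesis
  proof (cases "m < P")
    case True
    then have "(int P - 1 - int m) mod L = int (P - 1 - m)"
      by (subst mod_pos_pos_trivial) (auto simp: L_def P_def)
    then have "nat ((int P - 1 - j) mod L) = P - 1 - m" using refl by (simp only: nat_int)
    moreover have "P - 1 - m < P" using True by simp
    ultimately show ?thesis
      using True nth_palindrome[OF p, of m]
      by (simp add: m_def[symmetric] P_def nth_append)
  next
    case False
    have "(int P - 1 - int m) mod L = (int P - 1 - int m + L) mod L" by simp
    also have "\<dots> = int P - 1 - int m + L"
      using False mL by (intro mod_pos_pos_trivial) (auto simp: L_def P_def)
    also have "\<dots> = int (P + (length s - 1 - (m - P)))"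
      using False mL by (simp add: L_def P_def)
    finally have "nat ((int P - 1 - j) mod L) = P + (length s - 1 - (m - P))"
      using refl by (simp only: nat_int)
    moreover have "s ! (m - P) = s ! (length s - 1 - (m - P))"
      using False mL by (intro nth_palindrome[OF s]) (simp add: P_def)
    moreover have "(p @ s) ! m = s ! (m - P)" using False by (simp add: P_def nth_append)
    ultimately show ?thesis by (simp only: m_def P_def nth_append_length_plus)
  qed
qed

lemma power_of_prefix_if_period:
  assumes "has_period v g" "length v = k * g"
  shows "v = concat (replicate k (take g v))"
  using assms
proof (induction k arbitrary: v)
  case (Suc k)
  let ?t = "drop g v"
  have len: "length ?t = k * g" using Suc.prems by simp
  have "has_period ?t g"
    using Suc.prems(1) by (auto simp: has_period_def add.assoc)
  then have t: "?t = concat (replicate k (take g ?t))" using Suc.IH len by blast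
  have "replicate k (take g ?t) = replicate k (take g v)"
  proof (cases "k = 0")
    case False
    then have "g \<le> k * g" by simp
    then have "length v \<ge> g + g" using Suc.prems(2) by simp
    then have "take g ?t = take g v"
      using Suc.prems(1) by (intro nth_equalityI) (auto simp: has_period_def add.commute)
    then show ?thesis by simp
  qed simp
  then show ?case using t by (metis append_take_drop_id concat.simps(2) replicate_Suc)
qed simp

lemma palindromic_power_base:
  assumes "palindrome (concat (replicate k x))" "k \<ge> 1"
  shows "palindrome x"
proof -
  obtain m where m: "k = Suc m" using assms(2) by (cases k) auto
  have "concat (replicate k (rev x)) = concat (replicate k x)"
    using assms(1) by (simp add: palindrome_def rev_concat)
  then show ?thesis by (simp add: m palindrome_def)
qed

lemma factor_eq_take_drop: "factor w (i + 1) (i + n) = take n (drop i w)"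
  by (simp add: factor_def)

theorem theorem3p3:
  fixes w :: "'a list" and h r :: real and g i n :: nat
  assumes "g_word g w h r i n"
  shows "(\<exists>x k. palindrome x \<and> length x = g \<and> 1 \<le> k \<and>
            factor w (i + 1) (i + n) = concat (replicate k x)) \<and>
         has_period w g"
proof -
  from assms have off: "half_period_offset w h r" and inw: "i + n \<le> length w" and n0: "n \<noteq> 0"
    and pal: "palindrome (factor w (i + 1) (i + n))"
    and g: "g = gcd (nat \<lfloor>2 * \<bar>centre (i + 1) (i + n) - r\<bar>\<rfloor>) (nat \<lfloor>2 * h\<rfloor>)"
    and n: "real n = 2 * h - real g"
    by (auto simp: g_word_def)
  from off obtain p s where p: "palindrome p" and s: "palindrome s"
    and ne: "1 \<le> length (p @ s)"
    and w: "w = prefix (length w) ((p @ s)\<^sup>\<omega>)"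
    and h: "h = real (length (p @ s)) / 2" and r: "r = (real (length p) + 1) / 2"
    unfolding half_period_offset_def by blast
  define L where "L = length (p @ s)"
  define D where "D = 2 * int i + int n - int (length p)"
  define v where "v = factor w (i + 1) (i + n)"
  define U where "U j = (p @ s) ! nat (j mod int L)" for j :: int
  have Lpos: "L > 0" using ne unfolding L_def by (rule order.strict_trans2[OF zero_less_one])
  have twice_h: "nat \<lfloor>2 * h\<rfloor> = L"
    using half_period_floor_exact[OF off] by (simp add: h L_def)
  have "2 * \<bar>centre (i + 1) (i + n) - r\<bar> = \<bar>2 * (centre (i + 1) (i + n) - r)\<bar>"
    by (simp only: abs_mult abs_numeral)
  also have "2 * (centre (i + 1) (i + n) - r) = real_of_int D"
    by (simp add: centre_def r D_def field_simps)
  also have "\<bar>real_of_int D\<bar> = real_of_int \<bar>D\<bar>" by (rule of_int_abs[symmetric])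
  finally have "nat \<lfloor>2 * \<bar>centre (i + 1) (i + n) - r\<bar>\<rfloor> = nat \<bar>D\<bar>"
    by (simp only: floor_of_int)
  with g twice_h have g_nat: "g = gcd (nat \<bar>D\<bar>) L" by (simp only:)
  then have g_gcd: "int g = gcd D (int L)" by (simp only: gcd_int_def abs_of_nat nat_int)
  have gn: "L = n + g"
  proof -
    have "real L = real (n + g)" using n by (simp add: h L_def)
    then show ?thesis by (simp only: of_nat_eq_iff)
  qed
  have wU: "w ! j = U (int j)" if "j < length w" for j
  proof -
    have "w ! j = ((p @ s)\<^sup>\<omega>) j" using that by (subst w) simp
    also have "\<dots> = (p @ s) ! (j mod L)" using ne
      by (cases "p = []"; cases "s = []") (simp_all add: iter_def L_def)
    finally show ?thesis by (simp add: U_def flip: zmod_int)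
  qed
  have v: "v = take n (drop i w)" by (simp only: v_def factor_eq_take_drop)
  have len_v: "length v = n" using v inw by simp
  have v_nth: "v ! j = U (int i + int j)" if "j < n" for j
    using that inw by (simp add: v wU)
  have refl: "U (int (length p) - 1 - j) = U j" for j
    using palindrome_pair_reflection[OF p s, of j] ne
    by (cases "p = []"; cases "s = []") (simp_all add: U_def L_def)
  \<comment> \<open>The reflection of the \<open>g\<close>-word in its own centre, followed by that of \<open>U\<close> in the centre
      of \<open>p\<close>.\<close>
  have shift: "U j = U (j - D)" if "int i \<le> j" "j < int i + int L - int g" for j
  proof -
    define m where "m = nat (j - int i)"
    have m: "m < n" "j = int i + int m" using that gn by (auto simp: m_def)
    have "U j = v ! m" using m v_nth by simp
    also have "\<dots> = v ! (n - 1 - m)"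
      using nth_palindrome[of v m] pal m len_v by (simp add: v_def)
    also have "\<dots> = U (int i + int (n - 1 - m))" using m by (intro v_nth) simp
    also have "\<dots> = U (int (length p) - 1 - (int i + int (n - 1 - m)))" by (simp only: refl)
    also have "int (length p) - 1 - (int i + int (n - 1 - m)) = j - D"
      using m by (simp add: D_def of_nat_diff)
    finally show ?thesis .
  qed
  have "U (j + int g) = U j" for j
    using Lpos g_gcd shift
    by (intro period_gcd_of_partial_translation[of "int L" U "int g" D "int i"]) (auto simp: U_def)
  then have period: "has_period w g" by (auto simp: has_period_def wU)
  have "g dvd L" unfolding g_nat by (rule gcd_dvd2)
  then have "g dvd n" using gn by (simp add: dvd_add_left_iff)
  then obtain k where k: "n = k * g" by (metis dvdE mult.commute)
  have "k \<ge> 1" using k n0 by (cases k) auto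
  have "has_period v g"
    using period inw by (auto simp: has_period_def v add.assoc)
  then have pow: "v = concat (replicate k (take g v))"
    using k len_v by (intro power_of_prefix_if_period) simp_all
  moreover have "palindrome (take g v)"
  proof (rule palindromic_power_base)
    show "palindrome (concat (replicate k (take g v)))"
      using pal unfolding v_def[symmetric] by (subst (asm) pow)
  qed fact
  moreover have "length (take g v) = g" using len_v k \<open>k \<ge> 1\<close> by (cases k) auto
  ultimately show ?thesis using \<open>k \<ge> 1\<close> period unfolding v_def[symmetric] by blast
qed

end
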